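(* Let $(A,\omega)$ be a commutative baric $K$-algebra satisfying $2x^{2}x^{4}=\omega(x)^{2}x^{4}+\omega(x)^{4}x^{2}$ for all $x\in A$. Then $A$ is a principal train algebra of rank $3$ if and only if $A$ is a principal train algebra whose train equation is of the form $$x^3-(1+\gamma)\omega(x)x^2+\gamma\,\omega(x)^2x=0,\qquad \gamma\in\{0,\lambda,\bar\lambda\}.$$
   Context: $K$ is an algebraically closed (infinite, commutative) field of characteristic different from $2$. Algebras are commutative but not necessarily associative. A baric $K$-algebra $(A,\omega)$ is a $K$-algebra $A$ with a non-zero algebra homomorphism $\omega:A\to K$. Principal powers are $x^1=x$, $x^{k+1}=x\,x^{k}$. $(A,\omega)$ is a principal train algebra of rank $n\ge 2$ if there are $\gamma_1,\dots,\gamma_{n-1}\in K$ with $x^n+\gamma_1\omega(x)x^{n-1}+\dots+\gamma_{n-1}\omega(x)^{n-1}x=0$ for all $x\in A$, where $n\ge2$ is the smallest integer with this property; this equation of minimal degree is the train equation of $A$. Here $\lambda=\frac{-1-i\sqrt{23}}{4}$, $\bar\lambda=\frac{-1+i\sqrt{23}}{4}$, where $i\sqrt{23}$ denotes a fixed square root of $-23$ in $K$. *)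

theory Defs
  imports "HOL-Computational_Algebra.Polynomial"
begin

text \<open>
  A commutative, not necessarily associative algebra over a field: the underlying vector space
  is a type, with scalar multiplication \<open>scale\<close> and product \<open>mul\<close> as explicit parameters.
  Bilinearity is required in the left argument only; the right argument follows by commutativity.
\<close>

locale commutative_algebra = vector_space scale
  for scale :: "'k::field \<Rightarrow> 'a::ab_group_add \<Rightarrow> 'a" +
  fixes mul :: "'a \<Rightarrow> 'a \<Rightarrow> 'a"
  assumes mul_commute: "mul x y = mul y x"
    and mul_add_left: "mul (x + y) z = mul x z + mul y z"
    and mul_scale_left: "mul (scale c x) y = scale c (mul x y)"

locale commutative_baric_algebra = commutative_algebra scale mul
  for scale :: "'k::field \<Rightarrow> 'a::ab_group_add \<Rightarrow> 'a"
    and mul :: "'a \<Rightarrow> 'a \<Rightarrow> 'a" +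
  fixes \<omega> :: "'a \<Rightarrow> 'k"
  assumes weight_linear: "Vector_Spaces.linear scale (*) \<omega>"
    and weight_mul: "\<omega> (mul x y) = \<omega> x * \<omega> y"
    and weight_nonzero: "\<exists>x. \<omega> x \<noteq> 0"

text \<open>
  The value at exponent \<open>0\<close> is a dummy (an algebra need not have a unit);
  exponent \<open>0\<close> never occurs below.
\<close>

definition ppow :: "('a \<Rightarrow> 'a \<Rightarrow> 'a) \<Rightarrow> 'a \<Rightarrow> nat \<Rightarrow> 'a"
  where "ppow mul x k = (mul x ^^ (k - 1)) x"

lemma ppow_one: "ppow mul x 1 = x"
  by (simp add: ppow_def)

lemma ppow_Suc: "k \<ge> 1 \<Longrightarrow> ppow mul x (Suc k) = mul x (ppow mul x k)"
  by (cases k) (simp_all add: ppow_def)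

text \<open>
  A list \<open>[\<gamma>\<^sub>1, \<dots>, \<gamma>\<^sub>m]\<close> stands for the identity
  \<open>x\<^sup>n + \<gamma>\<^sub>1 \<omega>(x) x\<^sup>n\<^sup>-\<^sup>1 + \<dots> + \<gamma>\<^sub>m \<omega>(x)\<^sup>m x = 0\<close> of degree \<open>n = m + 1\<close>.
  Since lists are indexed from \<open>0\<close>, the entry at position \<open>i\<close> is \<open>\<gamma>\<^sub>i\<^sub>+\<^sub>1\<close>.
\<close>

definition train_identity ::
  "('k::field \<Rightarrow> 'a::ab_group_add \<Rightarrow> 'a) \<Rightarrow> ('a \<Rightarrow> 'a \<Rightarrow> 'a) \<Rightarrow> ('a \<Rightarrow> 'k) \<Rightarrow> 'k list \<Rightarrow> bool"
  where "train_identity scale mul \<omega> gs \<longleftrightarrow>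
    (\<forall>x. ppow mul x (length gs + 1) +
      (\<Sum>i<length gs. scale (gs ! i * \<omega> x ^ (i + 1)) (ppow mul x (length gs - i))) = 0)"

definition principal_train_algebra_of_rank ::
  "('k::field \<Rightarrow> 'a::ab_group_add \<Rightarrow> 'a) \<Rightarrow> ('a \<Rightarrow> 'a \<Rightarrow> 'a) \<Rightarrow> ('a \<Rightarrow> 'k) \<Rightarrow> nat \<Rightarrow> bool"
  where "principal_train_algebra_of_rank scale mul \<omega> n \<longleftrightarrow>
    n \<ge> 2 \<and>
    (\<exists>gs. length gs + 1 = n \<and> train_identity scale mul \<omega> gs) \<and>
    (\<forall>m. 2 \<le> m \<and> m < n \<longrightarrow> \<not> (\<exists>gs. length gs + 1 = m \<and> train_identity scale mul \<omega> gs))"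

definition principal_train_algebra ::
  "('k::field \<Rightarrow> 'a::ab_group_add \<Rightarrow> 'a) \<Rightarrow> ('a \<Rightarrow> 'a \<Rightarrow> 'a) \<Rightarrow> ('a \<Rightarrow> 'k) \<Rightarrow> bool"
  where "principal_train_algebra scale mul \<omega> \<longleftrightarrow>
    (\<exists>n. principal_train_algebra_of_rank scale mul \<omega> n)"

definition is_train_equation ::
  "('k::field \<Rightarrow> 'a::ab_group_add \<Rightarrow> 'a) \<Rightarrow> ('a \<Rightarrow> 'a \<Rightarrow> 'a) \<Rightarrow> ('a \<Rightarrow> 'k) \<Rightarrow> 'k list \<Rightarrow> bool"
  where "is_train_equation scale mul \<omega> gs \<longleftrightarrow>
    train_identity scale mul \<omega> gs \<and>
    principal_train_algebra_of_rank scale mul \<omega> (length gs + 1)"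

text \<open>The cubic case, with the principal powers and the sum written out.\<close>

lemma train_identity_cubic:
  "train_identity scale mul \<omega> [a, b] \<longleftrightarrow>
    (\<forall>x. ppow mul x 3 + (scale (a * \<omega> x) (ppow mul x 2) + scale (b * \<omega> x ^ 2) x) = 0)"
  by (simp add: train_identity_def ppow_one numeral_eq_Suc)
     (simp add: ppow_def)

end

theory Submission
  imports Defs
begin

text \<open>
  Only the implication from rank 3 to the three equations has content. Comparing weights forces a
  cubic train identity to be \<open>x\<^sup>3 - (1 + \<gamma>) \<omega>(x) x\<^sup>2 + \<gamma> \<omega>(x)\<^sup>2 x = 0\<close> for some
  \<open>\<gamma>\<close>, and because the rank is not 2 there is an \<open>x\<close> of weight 1 that is not idempotent. Put
  \<open>y = x\<^sup>2 - x \<noteq> 0\<close>. Then \<open>x\<^sup>2 = x + y\<close>, and the train identity says precisely that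
  \<open>x y = \<gamma> y\<close>. So every principal power of \<open>x\<close> lies in the span of \<open>x\<close> and \<open>y\<close>, and the
  product \<open>x\<^sup>2 x\<^sup>4\<close> involves only one further vector, \<open>y\<^sup>2\<close>. The given identity of degree 6
  becomes
  \<open>2 (1 + \<gamma> + \<gamma>\<^sup>2) y\<^sup>2 = - \<gamma> (2 \<gamma>\<^sup>2 + \<gamma> + 3) y\<close>
  (\<open>degree_six_identity_on_defect\<close>).

  Since \<open>y\<close> has weight 0, the train identity also gives \<open>y y\<^sup>2 = 0\<close>. A relation
  \<open>q y\<^sup>2 = c y\<close> with \<open>y \<noteq> 0\<close> is compatible with that only if \<open>c = 0\<close>
  (\<open>nil_cube_proportional\<close>); this holds even for \<open>q = 0\<close>, which is why the roots of
  \<open>1 + \<gamma> + \<gamma>\<^sup>2\<close> and characteristic 3 do not have to be treated separately. Hence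
  \<open>\<gamma> (2 \<gamma>\<^sup>2 + \<gamma> + 3) = 0\<close>, and completing the square, with discriminant \<open>1 - 24 = -23\<close>,
  gives the three values of \<open>\<gamma>\<close>.
\<close>

lemma two_neq_zero_if_CHAR_neq_2:
  assumes "CHAR('k::field) \<noteq> 2"
  shows "(2::'k) \<noteq> 0"
proof
  assume "(2::'k) = 0"
  then have "of_nat 2 = (0::'k)" by simp
  then have "CHAR('k) dvd 2" by (simp only: of_nat_eq_0_iff_char_dvd)
  then have "CHAR('k) = 1 \<or> CHAR('k) = 2"
    using two_is_prime_nat prime_nat_iff by blast
  then show False using assms by simp
qed

context commutative_algebra
begin

lemma mul_add_right: "mul x (y + z) = mul x y + mul x z"
  by (metis mul_add_left mul_commute)

lemma mul_scale_right: "mul x (scale c y) = scale c (mul x y)"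
  by (metis mul_scale_left mul_commute)

lemma mul_zero_right: "mul x 0 = 0"
  by (metis mul_scale_right scale_zero_left)

lemma mul_minus_right: "mul x (- y) = - mul x y"
  using mul_add_right[of x y "- y"] by (simp add: mul_zero_right eq_neg_iff_add_eq_0 add.commute)

lemma mul_diff_right: "mul x (y - z) = mul x y - mul x z"
  using mul_add_right[of x y "- z"] by (simp add: mul_minus_right)

text \<open>
  Multiplying \<open>q y\<^sup>2 = c y\<close> by \<open>y\<close> gives \<open>c y\<^sup>2 = 0\<close>, and multiplying the relation
  by \<open>c\<close> then gives \<open>c\<^sup>2 y = 0\<close>. There is no division by \<open>q\<close>.
\<close>

lemma nil_cube_proportional:
  assumes cube: "mul y (mul y y) = 0"
    and rel: "scale q (mul y y) = scale c y"
    and "y \<noteq> 0"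
  shows "c = 0"
proof -
  have "scale c (mul y y) = mul y (scale q (mul y y))"
    by (simp add: rel mul_scale_right)
  also have "\<dots> = 0" by (simp add: mul_scale_right cube)
  finally have "scale q (scale c (mul y y)) = 0" by simp
  then have "scale c (scale c y) = 0"
    by (metis rel scale_left_commute)
  then show ?thesis using \<open>y \<noteq> 0\<close> by simp
qed

text \<open>
  The two relations in the assumptions express all principal powers of \<open>x\<close> through \<open>x\<close>
  and \<open>y\<close>: \<open>x\<^sup>4 = x + q y\<close> with \<open>q = 1 + \<gamma> + \<gamma>\<^sup>2\<close>. Expanding
  \<open>2 (x + y) (x + q y) = (x + q y) + (x + y)\<close>, the terms in \<open>x\<close> cancel.
\<close>

lemma degree_six_identity_on_defect:
  assumes sq: "mul x x = x + y"
    and eig: "mul x y = scale \<gamma> y"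
    and identity: "scale 2 (mul (ppow mul x 2) (ppow mul x 4)) = ppow mul x 4 + ppow mul x 2"
  shows "scale (2 * (1 + \<gamma> + \<gamma>\<^sup>2)) (mul y y) = scale (- (\<gamma> * (2 * \<gamma>\<^sup>2 + \<gamma> + 3))) y"
proof -
  define q where "q = 1 + \<gamma> + \<gamma>\<^sup>2"
  have p2: "ppow mul x 2 = x + y"
    by (simp add: ppow_def numeral_eq_Suc sq)
  have "ppow mul x 4 = mul x (mul x (x + y))"
    by (simp add: ppow_def numeral_eq_Suc sq)
  also have "\<dots> = x + scale q y"
    by (simp add: q_def mul_add_right mul_scale_right sq eig scale_left_distrib power2_eq_square
        add_ac)
  finally have p4: "ppow mul x 4 = x + scale q y" .
  have eig': "mul y x = scale \<gamma> y" using eig mul_commute by simp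
  have "mul (x + y) (x + scale q y) = x + scale (1 + \<gamma> + q * \<gamma>) y + scale q (mul y y)"
    by (simp add: mul_add_right mul_add_left mul_scale_right sq eig eig' scale_left_distrib
        scale_right_distrib add_ac)
  then have "scale 2 (x + scale (1 + \<gamma> + q * \<gamma>) y + scale q (mul y y))
      = scale 2 x + scale (q + 1) y"
    using identity unfolding p2 p4
    by (simp add: scale_left_distrib[of 1 1, simplified] scale_left_distrib add_ac)
  then have "scale (2 * q) (mul y y) = scale (q + 1) y - scale (2 * (1 + \<gamma> + q * \<gamma>)) y"
    by (simp add: scale_right_distrib eq_diff_eq add_ac)
  also have "\<dots> = scale (q + 1 - 2 * (1 + \<gamma> + q * \<gamma>)) y"
    by (simp only: scale_left_diff_distrib)
  also have "q + 1 - 2 * (1 + \<gamma> + q * \<gamma>) = - (\<gamma> * (2 * \<gamma>\<^sup>2 + \<gamma> + 3))"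
    by (simp add: q_def algebra_simps power2_eq_square)
  finally show ?thesis by (simp add: q_def)
qed

end

context commutative_baric_algebra
begin

lemma weight_add: "\<omega> (x + y) = \<omega> x + \<omega> y"
  using weight_linear by (simp add: Vector_Spaces.linear_iff)

lemma weight_scale: "\<omega> (scale c x) = c * \<omega> x"
  using weight_linear by (simp add: Vector_Spaces.linear_iff)

lemma weight_zero: "\<omega> 0 = 0"
  using weight_scale[of 0 0] by simp

lemma weight_diff: "\<omega> (x - y) = \<omega> x - \<omega> y"
  using weight_add[of "x - y" y] by simp

lemma exists_weight_one: "\<exists>x. \<omega> x = 1"
proof -
  obtain x where "\<omega> x \<noteq> 0" using weight_nonzero by blast
  then have "\<omega> (scale (1 / \<omega> x) x) = 1" by (simp add: weight_scale)
  then show ?thesis by blast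
qed

lemma cubic_train_identity_mul:
  assumes "train_identity scale mul \<omega> [a, b]"
  shows "mul x (mul x x) + scale (a * \<omega> x) (mul x x) + scale (b * (\<omega> x)\<^sup>2) x = 0"
  using assms by (simp add: train_identity_cubic) (simp add: ppow_def numeral_eq_Suc add.assoc)

text \<open>The weights of the terms of the identity at an element of weight 1 are its coefficients.\<close>

lemma cubic_train_coefficients_sum:
  assumes "train_identity scale mul \<omega> [a, b]"
  shows "1 + a + b = 0"
proof -
  obtain x where x: "\<omega> x = 1" using exists_weight_one by blast
  have "\<omega> (mul x (mul x x) + scale (a * \<omega> x) (mul x x) + scale (b * (\<omega> x)\<^sup>2) x) = 0"
    using cubic_train_identity_mul[OF assms] weight_zero by simp
  then show ?thesis by (simp add: weight_add weight_scale weight_mul x)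
qed

text \<open>
  If all elements of weight 1 are idempotent, then so are \<open>e + n\<close> and \<open>e - n\<close> for \<open>e\<close>
  of weight 1 and \<open>n\<close> of weight 0. Adding the two resulting equations gives \<open>2 n\<^sup>2 = 0\<close>,
  and the elements of nonzero weight follow by rescaling, so that the rank is 2.
\<close>

lemma exists_weight_one_non_idempotent:
  assumes two: "(2::'k) \<noteq> 0"
    and not_rank_2: "\<not> train_identity scale mul \<omega> [-1]"
  shows "\<exists>x. \<omega> x = 1 \<and> mul x x \<noteq> x"
proof (rule ccontr)
  assume "\<not> ?thesis"
  then have idem: "mul x x = x" if "\<omega> x = 1" for x using that by blast
  obtain e where e: "\<omega> e = 1" using exists_weight_one by blast
  have "mul x x = scale (\<omega> x) x" for x
  proof (cases "\<omega> x = 0")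
    case True
    have sq: "mul e e = e" using idem e by blast
    have twist: "mul n e + mul n n = n - mul e n" if "\<omega> n = 0" for n
    proof -
      have "mul (e + n) (e + n) = e + n" using that e by (intro idem) (simp add: weight_add)
      then have "e + (mul n e + (mul e n + mul n n)) = e + n"
        by (simp add: mul_add_left mul_add_right sq add_ac)
      then show ?thesis by (simp add: eq_diff_eq add_ac)
    qed
    have neg: "mul (- x) z = - mul x z" for z by (metis mul_commute mul_minus_right)
    have "\<omega> (- x) = 0" using weight_diff[of 0 x] True by (simp add: weight_zero)
    from twist[OF this] have "mul x x = mul x e + mul e x - x"
      by (simp add: neg mul_minus_right algebra_simps)
    moreover from twist[OF True] have "mul x x = x - (mul x e + mul e x)"
      by (simp add: algebra_simps)
    ultimately have "mul x x + mul x x = (mul x e + mul e x - x) + (x - (mul x e + mul e x))"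
      by (simp only:)
    then have "mul x x + mul x x = 0" by simp
    then have "scale 2 (mul x x) = 0"
      using scale_left_distrib[of 1 1 "mul x x"] by simp
    then show ?thesis using two True by simp
  next
    case False
    let ?u = "scale (1 / \<omega> x) x"
    have "mul ?u ?u = ?u" using False by (intro idem) (simp add: weight_scale)
    then have "scale ((\<omega> x)\<^sup>2) (mul ?u ?u) = scale ((\<omega> x)\<^sup>2) ?u" by simp
    then show ?thesis
      using False by (simp add: mul_scale_left mul_scale_right power2_eq_square)
  qed
  then have "train_identity scale mul \<omega> [-1]"
    by (simp add: train_identity_def ppow_def)
  then show False using not_rank_2 by blast
qed

lemma cubic_train_parameter_root:
  assumes two: "(2::'k) \<noteq> 0"
    and train: "train_identity scale mul \<omega> [- (1 + \<gamma>), \<gamma>]"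
    and not_rank_2: "\<not> train_identity scale mul \<omega> [-1]"
    and identity: "\<And>x. scale 2 (mul (ppow mul x 2) (ppow mul x 4)) =
      scale (\<omega> x ^ 2) (ppow mul x 4) + scale (\<omega> x ^ 4) (ppow mul x 2)"
  shows "\<gamma> * (2 * \<gamma>\<^sup>2 + \<gamma> + 3) = 0"
proof -
  obtain x where x: "\<omega> x = 1" "mul x x \<noteq> x"
    using exists_weight_one_non_idempotent[OF two not_rank_2] by blast
  define y where "y = mul x x - x"
  have sq: "mul x x = x + y" by (simp add: y_def)
  have "mul x (mul x x) - mul x x = scale \<gamma> (mul x x - x)"
    using cubic_train_identity_mul[OF train, of x] x(1)
    by (simp add: scale_left_distrib scale_left_diff_distrib scale_right_diff_distrib
        scale_minus_left algebra_simps)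
  then have eig: "mul x y = scale \<gamma> y" by (simp add: y_def mul_diff_right)
  have "\<omega> y = 0" by (simp add: y_def weight_diff weight_mul x(1))
  then have cube: "mul y (mul y y) = 0"
    using cubic_train_identity_mul[OF train, of y] by simp
  have "scale (2 * (1 + \<gamma> + \<gamma>\<^sup>2)) (mul y y) = scale (- (\<gamma> * (2 * \<gamma>\<^sup>2 + \<gamma> + 3))) y"
    using identity[of x] x(1) by (intro degree_six_identity_on_defect[OF sq eig]) simp
  from nil_cube_proportional[OF cube this] show ?thesis using x(2) by (simp add: y_def)
qed

end

lemma quadratic_roots:
  fixes \<gamma> s :: "'k::field"
  assumes two: "(2::'k) \<noteq> 0" and s: "s\<^sup>2 = -23" and root: "2 * \<gamma>\<^sup>2 + \<gamma> + 3 = 0"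
  shows "\<gamma> = (-1 - s) / 4 \<or> \<gamma> = (-1 + s) / 4"
proof -
  have "(4::'k) = 2 * 2" by simp
  then have four: "(4::'k) \<noteq> 0" using two by (metis mult_eq_0_iff)
  have "(4 * \<gamma> + 1)\<^sup>2 - s\<^sup>2 = 8 * (2 * \<gamma>\<^sup>2 + \<gamma> + 3)"
    unfolding s by (simp add: power2_eq_square algebra_simps)
  then have "(4 * \<gamma> + 1)\<^sup>2 = s\<^sup>2" using root by simp
  then have "4 * \<gamma> + 1 = s \<or> 4 * \<gamma> + 1 = - s" by (simp only: power2_eq_iff)
  then have "\<gamma> * 4 = -1 + s \<or> \<gamma> * 4 = -1 - s" by (auto simp: algebra_simps eq_neg_iff_add_eq_0)
  then show ?thesis using nonzero_eq_divide_eq[OF four, of \<gamma>] by blast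
qed

theorem proposition5p3:
  fixes scale :: "'k::alg_closed_field \<Rightarrow> 'a::ab_group_add \<Rightarrow> 'a"
    and mul :: "'a \<Rightarrow> 'a \<Rightarrow> 'a"
    and \<omega> :: "'a \<Rightarrow> 'k"
    and s lam lam' :: 'k
  assumes char: "CHAR('k) \<noteq> 2"
    and s: "s ^ 2 = -23"
    and lam: "lam = (-1 - s) / 4"
    and lam': "lam' = (-1 + s) / 4"
    and baric: "commutative_baric_algebra scale mul \<omega>"
    and identity: "\<And>x. scale 2 (mul (ppow mul x 2) (ppow mul x 4)) =
      scale (\<omega> x ^ 2) (ppow mul x 4) + scale (\<omega> x ^ 4) (ppow mul x 2)"
  shows "principal_train_algebra_of_rank scale mul \<omega> 3 \<longleftrightarrow>
    principal_train_algebra scale mul \<omega> \<and>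
    (\<exists>\<gamma>\<in>{0, lam, lam'}. is_train_equation scale mul \<omega> [- (1 + \<gamma>), \<gamma>])"
proof
  assume rank: "principal_train_algebra_of_rank scale mul \<omega> 3"
  interpret commutative_baric_algebra scale mul \<omega> by (fact baric)
  have two: "(2::'k) \<noteq> 0" using two_neq_zero_if_CHAR_neq_2 char by blast
  obtain gs where gs: "length gs + 1 = 3" "train_identity scale mul \<omega> gs"
    using rank unfolding principal_train_algebra_of_rank_def by blast
  from gs(1) obtain a \<gamma> where "gs = [a, \<gamma>]"
    by (auto simp: numeral_eq_Suc length_Suc_conv)
  with gs(2) have ab: "train_identity scale mul \<omega> [a, \<gamma>]" by simp
  have "a + (1 + \<gamma>) = 0" using cubic_train_coefficients_sum[OF ab] by (simp add: add_ac)
  then have train: "train_identity scale mul \<omega> [- (1 + \<gamma>), \<gamma>]"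
    using ab by (simp only: eq_neg_iff_add_eq_0[symmetric])
  have "\<not> (\<exists>gs. length gs + 1 = 2 \<and> train_identity scale mul \<omega> gs)"
    using rank unfolding principal_train_algebra_of_rank_def by (auto dest: spec[of _ 2])
  then have "\<not> train_identity scale mul \<omega> [-1]" by (auto dest: spec[of _ "[-1]"])
  then have "\<gamma> * (2 * \<gamma>\<^sup>2 + \<gamma> + 3) = 0"
    using cubic_train_parameter_root two train identity by blast
  then have "\<gamma> \<in> {0, lam, lam'}"
    using quadratic_roots[OF two s, of \<gamma>] by (auto simp: lam lam')
  moreover have "is_train_equation scale mul \<omega> [- (1 + \<gamma>), \<gamma>]"
    using train rank by (simp add: is_train_equation_def numeral_eq_Suc)
  ultimately show "principal_train_algebra scale mul \<omega> \<and>
      (\<exists>\<gamma>\<in>{0, lam, lam'}. is_train_equation scale mul \<omega> [- (1 + \<gamma>), \<gamma>])"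
    using rank unfolding principal_train_algebra_def by blast
next
  assume "principal_train_algebra scale mul \<omega> \<and>
    (\<exists>\<gamma>\<in>{0, lam, lam'}. is_train_equation scale mul \<omega> [- (1 + \<gamma>), \<gamma>])"
  then obtain \<gamma> where "is_train_equation scale mul \<omega> [- (1 + \<gamma>), \<gamma>]" by blast
  then show "principal_train_algebra_of_rank scale mul \<omega> 3"
    by (simp add: is_train_equation_def numeral_eq_Suc)
qed

end
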